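(* Let $h\ge 2$. The map $f$ that sends a bargraph of width $h-1$ to the envelope of its stretched bargraph is a bijection from the set of bargraphs of width $h-1$ to the set of bubbles of width $h$.
   Context: Cells are unit squares of the square lattice, adjacent when they share an edge. A snake is a finite edge-connected set of cells, up to translation, whose adjacency graph has no cycle and all degrees at most two (so it is a path); it is partially directed if its cells can be listed from one end (tail) to the other (head) with every step North, East or West. Bargraph (rotated by 90 degrees): a polyomino formed by consecutive rows, from bottom to top, of lengths $a_1,\dots,a_m\ge 1$ ($m\ge 1$), where every row is a horizontal run of cells whose rightmost cell lies in one common column (all rows are right-justified against a vertical line). Its width is $\max_i a_i$. A well of height $k\ge 1$ is a maximal block of $k$ consecutive rows of the same length $h_1$ such that the row immediately below the block and the row immediately above it both exist and have lengths $h_0,h_2$ with $h_0>h_1<h_2$. The stretched bargraph is obtained by increasing the height of each well by two, i.e. inserting two additional rows of the same length in each well. The envelope of a (stretched) bargraph is the set of cells not in the bargraph that have a side or corner contact with it, excluding all cells lying to the right of the vertical line against which the rows are justified. Bubble of width $h$ (here with tail and head on the right): a partially directed snake whose tail and head lie in the same column, all of whose other cells lie in the $h-1$ columns immediately to the left of that column, and which has at least one cell in the leftmost of these $h-1$ columns. Bargraphs and bubbles are considered up to translation. *)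

theory Defs
  imports Main
begin

type_synonym cell = "int \<times> int"  \<comment> \<open>(column, row)\<close>

definition adjacent :: "cell \<Rightarrow> cell \<Rightarrow> bool" where
  "adjacent p q \<longleftrightarrow> \<bar>fst p - fst q\<bar> + \<bar>snd p - snd q\<bar> = 1"

definition edge_connected :: "cell set \<Rightarrow> bool" where
  "edge_connected S \<longleftrightarrow>
     (\<forall>p\<in>S. \<forall>q\<in>S. (p, q) \<in> {(u, v). u \<in> S \<and> v \<in> S \<and> adjacent u v}\<^sup>*)"

definition is_cycle_in :: "cell set \<Rightarrow> cell list \<Rightarrow> bool" where
  "is_cycle_in S cs \<longleftrightarrow> 3 \<le> length cs \<and> distinct cs \<and> set cs \<subseteq> S \<and>
     successively adjacent cs \<and> adjacent (last cs) (hd cs)"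

definition snake :: "cell set \<Rightarrow> bool" where
  "snake S \<longleftrightarrow> finite S \<and> S \<noteq> {} \<and> edge_connected S \<and>
     (\<nexists>cs. is_cycle_in S cs) \<and> (\<forall>p\<in>S. card {q \<in> S. adjacent p q} \<le> 2)"

definition new_step :: "cell \<Rightarrow> cell \<Rightarrow> bool" where
  "new_step p q \<longleftrightarrow>
     q = (fst p, snd p + 1) \<or> q = (fst p + 1, snd p) \<or> q = (fst p - 1, snd p)"

text \<open>The steps of a listing go North, East or West; the tail is \<open>hd xs\<close> and the
  head is \<open>last xs\<close>.\<close>

definition directed_listing :: "cell set \<Rightarrow> cell list \<Rightarrow> bool" where
  "directed_listing S xs \<longleftrightarrow>
     xs \<noteq> [] \<and> distinct xs \<and> set xs = S \<and> successively new_step xs"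

definition partially_directed_snake :: "cell set \<Rightarrow> bool" where
  "partially_directed_snake S \<longleftrightarrow> snake S \<and> (\<exists>xs. directed_listing S xs)"

definition bubble :: "nat \<Rightarrow> cell set \<Rightarrow> bool" where
  "bubble h S \<longleftrightarrow> partially_directed_snake S \<and>
     (\<exists>xs c. directed_listing S xs \<and> fst (hd xs) = c \<and> fst (last xs) = c \<and>
        (\<forall>p \<in> S - {hd xs, last xs}. fst p \<in> {c - (int h - 1)..c - 1}) \<and>
        (\<exists>p \<in> S. fst p = c - (int h - 1)))"

text \<open>The rows of lengths \<open>a\<close>, listed from bottom to top: the lowest one lies in row \<open>b\<close>,
  and the rightmost cells all lie in column \<open>c\<close>.\<close>

definition bar_cells :: "int \<Rightarrow> int \<Rightarrow> nat list \<Rightarrow> cell set" where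
  "bar_cells c b a =
     {(x, y). \<exists>i < length a. y = b + int i \<and> c - int (a ! i) < x \<and> x \<le> c}"

definition bargraphs :: "nat \<Rightarrow> cell set set" where
  "bargraphs w =
     {bar_cells c b a | c b a. a \<noteq> [] \<and> (\<forall>k \<in> set a. 1 \<le> k) \<and> Max (set a) = w}"

definition right_column :: "cell set \<Rightarrow> int" where
  "right_column P = Max (fst ` P)"

definition bottom_row :: "cell set \<Rightarrow> int" where
  "bottom_row P = Min (snd ` P)"

definition top_row :: "cell set \<Rightarrow> int" where
  "top_row P = Max (snd ` P)"

definition row_lengths :: "cell set \<Rightarrow> nat list" where
  "row_lengths P = map (\<lambda>y. card {x. (x, y) \<in> P}) [bottom_row P..top_row P]"

text \<open>Rows \<open>i, \<dots>, i + k - 1\<close> (counted from \<open>0\<close>) form a well of height \<open>k\<close>. The strict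
  inequalities make the block maximal.\<close>

definition is_well :: "nat list \<Rightarrow> nat \<Rightarrow> nat \<Rightarrow> bool" where
  "is_well a i k \<longleftrightarrow> 1 \<le> k \<and> 1 \<le> i \<and> i + k < length a \<and>
     (\<forall>j \<in> {i..<i + k}. a ! j = a ! i) \<and> a ! (i - 1) > a ! i \<and> a ! i < a ! (i + k)"

text \<open>A well has equal rows, so the two rows can be inserted next to its lowest one, which is
  written three times instead of once.\<close>

definition stretch_rows :: "nat list \<Rightarrow> nat list" where
  "stretch_rows a =
     concat (map (\<lambda>i. replicate (if \<exists>k. is_well a i k then 3 else 1) (a ! i)) [0..<length a])"

text \<open>The right column and the bottom row stay in place, so that stretching commutes with
  translations.\<close>

definition stretched :: "cell set \<Rightarrow> cell set" where
  "stretched P = bar_cells (right_column P) (bottom_row P) (stretch_rows (row_lengths P))"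

definition envelope :: "cell set \<Rightarrow> cell set" where
  "envelope P = {(x, y). (x, y) \<notin> P \<and> x \<le> right_column P \<and>
     (\<exists>(x', y') \<in> P. \<bar>x - x'\<bar> \<le> 1 \<and> \<bar>y - y'\<bar> \<le> 1)}"

definition translate :: "int \<Rightarrow> int \<Rightarrow> cell set \<Rightarrow> cell set" where
  "translate u v S = (\<lambda>(x, y). (x + u, y + v)) ` S"

definition translation_rel :: "(cell set \<times> cell set) set" where
  "translation_rel = {(S, T). \<exists>u v. T = translate u v S}"

definition bargraph_classes :: "nat \<Rightarrow> cell set set set" where
  "bargraph_classes w = bargraphs w // translation_rel"

definition bubble_classes :: "nat \<Rightarrow> cell set set set" where
  "bubble_classes h = {S. bubble h S} // translation_rel"

text \<open>The map on translation classes. The image of a class is taken elementwise, so its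
  membership in \<open>bubble_classes h\<close> says in particular that it is a whole translation class.\<close>

definition envelope_map :: "cell set set \<Rightarrow> cell set set" where
  "envelope_map C = (\<lambda>P. envelope (stretched P)) ` C"

end

theory Submission
  imports Defs
begin

text \<open>
  Let \<open>L y\<close> be the length of row \<open>y\<close> of a bargraph, with value \<open>0\<close> outside the bargraph. In the
  envelope, row \<open>y\<close> runs between the distances \<open>D y = max (L (y - 1)) (L y)\<close> and \<open>D (y + 1)\<close> from
  the vertical line, except when row \<open>y\<close> is a well of height one. So the envelope of a
  stretched bargraph is the directed path that steps North into row \<open>y\<close> at distance \<open>D y\<close>.
  Such a path is a snake if and only if \<open>D\<close> has no strict local extremum: at an extremum two
  consecutive rows overlap in a square. For \<open>D\<close> built from \<open>L\<close> this says that all wells of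
  \<open>L\<close> have height at least three, and such \<open>L\<close> are exactly the stretched ones. Conversely,
  the bargraph is recovered from a bubble by \<open>L y = min (D y) (D (y + 1))\<close>.
\<close>

section \<open>Snakes as zigzags\<close>

text \<open>\<open>D y\<close> is the column in which a path enters row \<open>y\<close>; it leaves that row in column
  \<open>D (y + 1)\<close>.\<close>

definition zigzag :: "(int \<Rightarrow> int) \<Rightarrow> int \<Rightarrow> int \<Rightarrow> cell set" where
  "zigzag D s t =
     {(x, y). s \<le> y \<and> y \<le> t \<and> min (D y) (D (y + 1)) \<le> x \<and> x \<le> max (D y) (D (y + 1))}"

definition tame :: "(int \<Rightarrow> int) \<Rightarrow> int \<Rightarrow> int \<Rightarrow> bool" where
  "tame D s t \<longleftrightarrow> (\<forall>y. s < y \<and> y \<le> t \<longrightarrow>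
     \<not> (D (y - 1) < D y \<and> D (y + 1) < D y) \<and> \<not> (D y < D (y - 1) \<and> D y < D (y + 1)))"

text \<open>Prepending a cell either lengthens the lowest row by one, so that only
  \<open>D s\<close> changes, or opens a new one-cell row below. Distinctness keeps the lowest row
  from folding back.\<close>

lemma listing_zigzag:
  assumes "xs \<noteq> []" "distinct xs" "successively new_step xs"
  shows "\<exists>D s t. s \<le> t \<and> hd xs = (D s, s) \<and> last xs = (D (t + 1), t) \<and> set xs = zigzag D s t"
  using assms
proof (induction xs)
  case (Cons p xs)
  obtain x y where p: "p = (x, y)" by (cases p)
  show ?case
  proof (cases "xs = []")
    case True
    have "set (p # xs) = zigzag (\<lambda>_. x) y y"
      using True p by (auto simp: zigzag_def)
    moreover have "hd (p # xs) = (x, y)" "last (p # xs) = (x, y)" using True p by auto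
    ultimately show ?thesis by (metis order_refl)
  next
    case False
    with Cons obtain D s t where D: "s \<le> t" "hd xs = (D s, s)" "last xs = (D (t + 1), t)"
      "set xs = zigzag D s t"
      by (auto simp: successively_Cons)
    have step: "new_step p (D s, s)" using Cons.prems False D by (auto simp: successively_Cons)
    have notin: "(x, y) \<notin> zigzag D s t" using Cons.prems p D by auto
    show ?thesis
    proof (cases "s = y")
      case True
      let ?D = "D(y := x)"
      have d: "D s = x + 1 \<or> D s = x - 1" using step p True by (auto simp: new_step_def)
      have "x < min (D s) (D (s + 1)) \<or> x > max (D s) (D (s + 1))"
        using notin D(1) True by (auto simp: zigzag_def)
      with d have row: "min x (D (s + 1)) \<le> z \<and> z \<le> max x (D (s + 1)) \<longleftrightarrow>
          z = x \<or> min (D s) (D (s + 1)) \<le> z \<and> z \<le> max (D s) (D (s + 1))" for z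
        by linarith
      have "q \<in> set (p # xs) \<longleftrightarrow> q \<in> zigzag ?D s t" for q
      proof (cases q)
        case (Pair z w)
        then show ?thesis using row[of z] p True D(1) unfolding list.set D(4)
          by (cases "w = s") (auto simp: zigzag_def)
      qed
      then have "set (p # xs) = zigzag ?D s t" by blast
      moreover have "hd (p # xs) = (?D s, s)" "last (p # xs) = (?D (t + 1), t)"
        using D p True False by auto
      ultimately show ?thesis using D(1) by blast
    next
      case False': False
      \<comment> \<open>A North step keeps the column, so the new row is entered and left in column
        \<open>x\<close>.\<close>
      then have d: "s = y + 1" "D s = x" using step p by (auto simp: new_step_def)
      let ?D = "D(y := x)"
      have "q \<in> set (p # xs) \<longleftrightarrow> q \<in> zigzag ?D y t" for q
      proof (cases q)
        case (Pair z w)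
        then show ?thesis using d p D(1) unfolding list.set D(4)
          by (cases "w = y") (auto simp: zigzag_def)
      qed
      then have "set (p # xs) = zigzag ?D y t" by blast
      moreover have "hd (p # xs) = (?D y, y)" "last (p # xs) = (?D (t + 1), t)" "y \<le> t"
        using D p d False by auto
      ultimately show ?thesis by blast
    qed
  qed
qed simp

text \<open>Tame zigzags have no chords: prepending a cell to the listing creates no adjacency other
  than the one with the previous first cell.\<close>

fun induced_path :: "cell list \<Rightarrow> bool" where
  "induced_path [] \<longleftrightarrow> True"
| "induced_path (p # xs) \<longleftrightarrow>
     p \<notin> set xs \<and> (\<forall>q \<in> set xs. adjacent p q \<longleftrightarrow> q = hd xs) \<and> induced_path xs"

lemma adjacent_sym: "adjacent p q \<longleftrightarrow> adjacent q p"
  by (auto simp: adjacent_def)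

lemma not_adjacent_self: "\<not> adjacent p p"
  by (auto simp: adjacent_def)

lemma induced_path_distinct: "induced_path xs \<Longrightarrow> distinct xs"
  by (induction xs) auto

text \<open>Removing the first cell drops a one-cell lowest row or brings its entry one closer to
  its exit, hence the lexicographic measure.\<close>

lemma zigzag_listing:
  assumes "s \<le> t" "tame D s t"
  shows "\<exists>xs. xs \<noteq> [] \<and> hd xs = (D s, s) \<and> last xs = (D (t + 1), t) \<and> set xs = zigzag D s t \<and>
    successively new_step xs \<and> induced_path xs"
  using assms
proof (induction "(nat (t - s), nat \<bar>D s - D (s + 1)\<bar>)" arbitrary: s D
    rule: wf_induct_rule[OF wf_lex_prod[OF wf_less_than wf_less_than]])
  case 1
  show ?case
  proof (cases "D s = D (s + 1)")
    case True
    show ?thesis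
    proof (cases "s = t")
      case True': True
      have "set [(D s, s)] = zigzag D s t" using True True' by (auto simp: zigzag_def)
      then show ?thesis using True True' by (intro exI[of _ "[(D s, s)]"]) auto
    next
      case False
      have "tame D (s + 1) t" using "1.prems" by (auto simp: tame_def)
      with "1.prems" False obtain xs where xs: "xs \<noteq> []" "hd xs = (D (s + 1), s + 1)"
        "last xs = (D (t + 1), t)" "set xs = zigzag D (s + 1) t" "successively new_step xs"
        "induced_path xs"
        using "1.hyps"[of "s + 1" D] by auto
      have "q \<in> zigzag D s t \<longleftrightarrow> q \<in> set ((D s, s) # xs)" for q
      proof (cases q)
        case (Pair z w)
        then show ?thesis using True "1.prems"(1) unfolding list.set xs(4)
          by (cases "w = s") (auto simp: zigzag_def)
      qed
      moreover have "induced_path ((D s, s) # xs)"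
        using xs True by (auto simp: zigzag_def adjacent_def)
      ultimately show ?thesis using xs True
        by (intro exI[of _ "(D s, s) # xs"]) (auto simp: successively_Cons new_step_def)
    qed
  next
    case False
    define x where "x = (if D s < D (s + 1) then D s + 1 else D s - 1)"
    let ?D = "D(s := x)"
    \<comment> \<open>Moving \<open>D s\<close> towards \<open>D (s + 1)\<close> creates no strict
      inequality between them that did not hold before, hence no new extremum.\<close>
    have tame: "tame ?D s t"
      unfolding tame_def
    proof (intro allI impI)
      fix y assume y: "s < y \<and> y \<le> t"
      then have T: "\<not> (D (y - 1) < D y \<and> D (y + 1) < D y)" "\<not> (D y < D (y - 1) \<and> D y < D (y + 1))"
        using "1.prems" by (auto simp: tame_def)
      have "y = s + 1 \<or> y - 1 \<noteq> s" by auto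
      then show "\<not> (?D (y - 1) < ?D y \<and> ?D (y + 1) < ?D y) \<and> \<not> (?D y < ?D (y - 1) \<and> ?D y < ?D (y + 1))"
        using y T False by (auto simp: x_def split: if_splits)
    qed
    have "nat \<bar>x - D (s + 1)\<bar> < nat \<bar>D s - D (s + 1)\<bar>" using False by (auto simp: x_def)
    with tame "1.prems"(1) obtain xs where xs: "xs \<noteq> []" "hd xs = (x, s)"
        "last xs = (D (t + 1), t)" "set xs = zigzag ?D s t" "successively new_step xs"
        "induced_path xs"
        using "1.hyps"[of s ?D] by auto
    have row: "min (D s) (D (s + 1)) \<le> z \<and> z \<le> max (D s) (D (s + 1)) \<longleftrightarrow>
        z = D s \<or> min x (D (s + 1)) \<le> z \<and> z \<le> max x (D (s + 1))" for z
      using False by (auto simp: x_def)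
    have "q \<in> zigzag D s t \<longleftrightarrow> q \<in> set ((D s, s) # xs)" for q
    proof (cases q)
      case (Pair z w)
      then show ?thesis using row[of z] "1.prems"(1) unfolding list.set xs(4)
        by (cases "w = s") (auto simp: zigzag_def)
    qed
    moreover have "(D s, s) \<notin> zigzag ?D s t"
      using False by (auto simp: zigzag_def x_def)
    moreover have "adjacent (D s, s) q \<longleftrightarrow> q = (x, s)" if q: "q \<in> zigzag ?D s t" for q
    proof
      assume adj: "adjacent (D s, s) q"
      obtain z w where zw: "q = (z, w)" by (cases q)
      have w: "s \<le> w" using q zw by (auto simp: zigzag_def)
      \<comment> \<open>A chord upwards would need the cell above \<open>(D s, s)\<close>. By
        tameness row \<open>s + 1\<close> does not turn back from \<open>D (s + 1)\<close> towards
        \<open>D s\<close>, so it misses that cell.\<close>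
      have "w \<noteq> s + 1"
      proof
        assume "w = s + 1"
        moreover from this have "z = D s" using adj zw by (auto simp: adjacent_def)
        moreover have "\<not> (D s < D (s + 1) \<and> D (s + 2) < D (s + 1))"
          "\<not> (D (s + 1) < D s \<and> D (s + 1) < D (s + 2))" if "s + 1 \<le> t"
          using that "1.prems"(2)[unfolded tame_def, rule_format, of "s + 1"]
          by (auto simp: add.commute)
        ultimately show False using q zw False
          by (auto simp: zigzag_def add.assoc min_le_iff_disj le_max_iff_disj)
      qed
      with adj zw w have "w = s" "z = D s + 1 \<or> z = D s - 1" by (auto simp: adjacent_def)
      then show "q = (x, s)" using q zw False by (auto simp: zigzag_def x_def split: if_splits)
    qed (auto simp: adjacent_def x_def)
    ultimately show ?thesis using xs
      by (intro exI[of _ "(D s, s) # xs"]) (auto simp: successively_Cons new_step_def x_def)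
  qed
qed

section \<open>Induced paths are snakes\<close>

lemma edge_connected_insert:
  assumes "edge_connected S" "q \<in> S" "adjacent p q"
  shows "edge_connected (insert p S)"
proof -
  let ?r = "{(u, v). u \<in> S \<and> v \<in> S \<and> adjacent u v}"
  let ?R = "{(u, v). u \<in> insert p S \<and> v \<in> insert p S \<and> adjacent u v}"
  have "?r\<^sup>* \<subseteq> ?R\<^sup>*" by (rule rtrancl_mono) auto
  then have S: "(u, v) \<in> ?R\<^sup>*" if "u \<in> S" "v \<in> S" for u v
    using assms(1) that by (auto simp: edge_connected_def)
  have "(p, q) \<in> ?R" "(q, p) \<in> ?R" using assms by (auto simp: adjacent_sym)
  then have "(p, v) \<in> ?R\<^sup>*" "(v, p) \<in> ?R\<^sup>*" if "v \<in> S" for v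
    using S[OF assms(2) that] S[OF that assms(2)]
    by (meson converse_rtrancl_into_rtrancl rtrancl.rtrancl_into_rtrancl)+
  then show ?thesis using S unfolding edge_connected_def by blast
qed

lemma cycle_neighbours:
  assumes "is_cycle_in S cs" "p \<in> set cs"
  shows "\<exists>q r. q \<in> S - {p} \<and> r \<in> S - {p} \<and> q \<noteq> r \<and> adjacent p q \<and> adjacent p r"
proof -
  from assms(2) obtain us vs where cs: "cs = us @ p # vs" by (meson split_list)
  \<comment> \<open>The cycle is rotated to start at \<open>p\<close>; its remaining cells
    \<open>ds\<close> begin and end with neighbours of \<open>p\<close>, distinct because a cycle
    has at least three cells.\<close>
  define ds where "ds = vs @ us"
  have len: "2 \<le> length ds" and dist: "distinct (p # ds)" and sub: "set ds \<subseteq> S"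
    using assms(1) cs by (auto simp: is_cycle_in_def ds_def)
  have "adjacent p (hd ds)"
    using assms(1) len unfolding is_cycle_in_def cs ds_def
    by (cases vs; cases us) (auto simp: successively_append_iff successively_Cons)
  moreover have "adjacent p (last ds)"
    using assms(1) len unfolding is_cycle_in_def cs ds_def
    by (cases vs rule: rev_cases; cases us rule: rev_cases)
       (auto simp: successively_append_iff successively_Cons adjacent_sym)
  moreover have "hd ds \<noteq> last ds" "hd ds \<in> set ds" "last ds \<in> set ds"
  proof -
    obtain u ds' where "ds = u # ds'" "ds' \<noteq> []" using len by (cases ds; cases "tl ds") auto
    then show "hd ds \<noteq> last ds" "hd ds \<in> set ds" "last ds \<in> set ds" using dist by auto
  qed
  ultimately show ?thesis using dist sub
    by (intro exI[of _ "hd ds"] exI[of _ "last ds"]) auto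
qed

text \<open>The new first cell has a single neighbour, so it lies on no cycle. Only the previous
  first cell gains a neighbour, and as an end of the old path it had at most one.\<close>

lemma induced_path_snake:
  assumes "induced_path xs" "xs \<noteq> []"
  shows "snake (set xs)"
  using assms
proof (induction xs)
  case (Cons p xs)
  show ?case
  proof (cases "xs = []")
    case True
    have "\<not> is_cycle_in {p} cs" for cs
      using cycle_neighbours[of "{p}" cs p] by (cases cs) (auto simp: is_cycle_in_def)
    moreover have "edge_connected {p}" by (simp add: edge_connected_def)
    ultimately show ?thesis using True
      by (simp add: snake_def not_adjacent_self cong: conj_cong)
  next
    case False
    have IH: "snake (set xs)" using Cons False by auto
    have p: "p \<notin> set xs" and adj: "\<And>q. q \<in> set xs \<Longrightarrow> adjacent p q \<longleftrightarrow> q = hd xs"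
      using Cons.prems by auto
    have "\<not> is_cycle_in (set (p # xs)) cs" for cs
    proof
      assume cyc: "is_cycle_in (set (p # xs)) cs"
      show False
      proof (cases "p \<in> set cs")
        case True
        then obtain q r where "q \<in> set xs" "r \<in> set xs" "q \<noteq> r" "adjacent p q" "adjacent p r"
          using cycle_neighbours[OF cyc True] by auto
        then show False using adj by metis
      next
        case False
        then have "is_cycle_in (set xs) cs" using cyc by (auto simp: is_cycle_in_def)
        then show False using IH by (auto simp: snake_def)
      qed
    qed
    moreover have "edge_connected (set (p # xs))"
      using edge_connected_insert[of "set xs" "hd xs" p] IH adj False by (auto simp: snake_def)
    moreover have "card {r \<in> set (p # xs). adjacent q r} \<le> 2" if q: "q \<in> set (p # xs)" for q
    proof -
      consider "q = p" | "q = hd xs" | "q \<in> set xs" "q \<noteq> hd xs" "q \<noteq> p" using q by auto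
      then show ?thesis
      proof cases
        case 1
        then have "{r \<in> set (p # xs). adjacent q r} \<subseteq> {hd xs}"
          using adj by (auto simp: not_adjacent_self)
        from card_mono[OF _ this] show ?thesis by simp
      next
        case 2
        obtain ys where ys: "xs = q # ys" using 2 False by (cases xs) auto
        \<comment> \<open>For empty \<open>ys\<close> the cell \<open>hd ys\<close> is unspecified,
          which is harmless in an upper bound.\<close>
        then have "{r \<in> set (p # xs). adjacent q r} \<subseteq> {p, hd ys}"
          using Cons.prems by (auto simp: not_adjacent_self)
        from card_mono[OF _ this] show ?thesis by (simp add: card_insert_if split: if_splits)
      next
        case 3
        then have "\<not> adjacent q p" using adj[of q] by (metis adjacent_sym)
        then have "{r \<in> set (p # xs). adjacent q r} = {r \<in> set xs. adjacent q r}" by auto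
        then show ?thesis using IH 3 by (auto simp: snake_def)
      qed
    qed
    ultimately show ?thesis unfolding snake_def by auto
  qed
qed simp

lemma snake_no_square:
  assumes "snake S"
  shows "\<not> {(x, y), (x + 1, y), (x, y + 1), (x + 1, y + 1)} \<subseteq> S"
proof
  assume "{(x, y), (x + 1, y), (x, y + 1), (x + 1, y + 1)} \<subseteq> S"
  then have "is_cycle_in S [(x, y), (x + 1, y), (x + 1, y + 1), (x, y + 1)]"
    by (auto simp: is_cycle_in_def adjacent_def)
  with assms show False by (auto simp: snake_def)
qed

text \<open>A strict local extremum of \<open>D\<close> makes two consecutive rows overlap in a
  2-by-2 square, which is a cycle.\<close>

lemma snake_zigzag_tame:
  assumes "snake (zigzag D s t)"
  shows "tame D s t"
  unfolding tame_def
proof (intro allI impI)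
  fix y assume y: "s < y \<and> y \<le> t"
  have sq: "\<not> {(x, y - 1), (x + 1, y - 1), (x, y), (x + 1, y)} \<subseteq> zigzag D s t" for x
    using snake_no_square[OF assms, of x "y - 1"] by simp
  \<comment> \<open>At a maximum the square has its right column at \<open>D y\<close>, at a minimum
    its left column.\<close>
  show "\<not> (D (y - 1) < D y \<and> D (y + 1) < D y) \<and> \<not> (D y < D (y - 1) \<and> D y < D (y + 1))"
    using sq[of "D y - 1"] sq[of "D y"] y by (auto simp: zigzag_def)
qed

section \<open>Stretching lists of row lengths\<close>

text \<open>The upper half of the well condition, for a row of length \<open>x\<close> with the list
  above it: the run of rows of length \<open>x\<close> is closed by a longer row.\<close>

fun rises :: "nat \<Rightarrow> nat list \<Rightarrow> bool" where
  "rises x [] \<longleftrightarrow> False"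
| "rises x (y # ys) \<longleftrightarrow> x < y \<or> x = y \<and> rises x ys"

text \<open>Here and below, \<open>p\<close> is the length of the row below the list. Starting from \<open>p = 0\<close>
  ensures that the bottom row never belongs to a well.\<close>

fun stretch_from :: "nat \<Rightarrow> nat list \<Rightarrow> nat list" where
  "stretch_from p [] = []"
| "stretch_from p (x # xs) =
     (if x < p \<and> rises x xs then [x, x, x] else [x]) @ stretch_from x xs"

text \<open>Meant as the inverse of \<open>stretch_from\<close>: two rows are removed above the
  lowest row of each well.\<close>

function unstretch_from :: "nat \<Rightarrow> nat list \<Rightarrow> nat list" where
  "unstretch_from p [] = []"
| "unstretch_from p (x # xs) =
     x # unstretch_from x (if x < p \<and> rises x xs then drop 2 xs else xs)"
  by pat_completeness auto
termination by (relation "measure (length \<circ> snd)") auto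

text \<open>All wells have height at least three, which characterises the image of
  stretching.\<close>

fun wide_from :: "nat \<Rightarrow> nat list \<Rightarrow> bool" where
  "wide_from p [] \<longleftrightarrow> True"
| "wide_from p (x # xs) \<longleftrightarrow>
     (x < p \<and> rises x xs \<longrightarrow> (\<exists>zs. xs = x # x # zs)) \<and> wide_from x xs"

text \<open>Entries equal to the preceding \<open>x\<close> start no well and are copied once, so
  the initial run of \<open>x\<close> and the first entry after it survive. Hence the same wells are
  detected before and after stretching.\<close>

lemma rises_stretch_from: "rises x (stretch_from x xs) \<longleftrightarrow> rises x xs"
  by (induction xs) auto

lemma unstretch_stretch: "unstretch_from p (stretch_from p xs) = xs"
  by (induction xs arbitrary: p) (auto simp: rises_stretch_from)

lemma set_stretch_from: "set (stretch_from p xs) = set xs"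
  by (induction xs arbitrary: p) auto

lemma wide_stretch_from: "wide_from p (stretch_from p xs)"
  by (induction xs arbitrary: p) (auto simp: rises_stretch_from)

lemma rises_unstretch_from: "rises x (unstretch_from x xs) \<longleftrightarrow> rises x xs"
  by (induction xs) auto

text \<open>Wideness guarantees that the two dropped entries equal \<open>x\<close>, so stretching
  restores exactly them.\<close>

lemma stretch_unstretch: "wide_from p xs \<Longrightarrow> stretch_from p (unstretch_from p xs) = xs"
  by (induction p xs rule: unstretch_from.induct) (auto simp: rises_unstretch_from)

section \<open>Wells and short wells in terms of indices\<close>

lemma rises_iff:
  "rises x xs \<longleftrightarrow> (\<exists>j < length xs. (\<forall>i<j. xs ! i = x) \<and> x < xs ! j)"
proof (induction xs)
  case (Cons y ys)
  show ?case unfolding rises.simps Cons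
    by (auto simp: Ex_less_Suc2 All_less_Suc2)
qed simp

text \<open>The height is determined by the first row above \<open>i\<close> of a different length,
  so its existence becomes a test on the suffix above \<open>i\<close>.\<close>

lemma is_well_iff:
  "(\<exists>k. is_well a i k) \<longleftrightarrow> 1 \<le> i \<and> i < length a \<and> a ! i < a ! (i - 1) \<and> rises (a ! i) (drop (Suc i) a)"
  (is "?l \<longleftrightarrow> ?r")
proof
  assume ?l
  then obtain k where k: "is_well a i k" by blast
  then have b: "1 \<le> k" "1 \<le> i" "i + k < length a" "a ! i < a ! (i - 1)" "a ! i < a ! (i + k)"
    and eq: "\<forall>j \<in> {i..<i + k}. a ! j = a ! i"
    unfolding is_well_def by blast+
  have "drop (Suc i) a ! j = a ! i" if "j < k - 1" for j
    using bspec[OF eq, of "Suc i + j"] that b by simp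
  moreover have "a ! i < drop (Suc i) a ! (k - 1)" using b by simp
  moreover have "k - 1 < length (drop (Suc i) a)" using b by simp
  ultimately have "rises (a ! i) (drop (Suc i) a)" unfolding rises_iff by blast
  then show ?r using b by simp
next
  assume r: ?r
  then obtain j where j: "j < length a - Suc i" "\<forall>m<j. a ! (Suc i + m) = a ! i"
    "a ! i < a ! (Suc i + j)" by (fastforce simp: rises_iff)
  have "a ! m = a ! i" if "m \<in> {i..<i + Suc j}" for m
    using that j(2)[rule_format, of "m - Suc i"] by (cases "m = i") auto
  moreover have "i + Suc j < length a" "a ! i < a ! (i + Suc j)" "1 \<le> Suc j"
    using j by auto
  ultimately have "is_well a i (Suc j)" using r unfolding is_well_def by blast
  then show ?l by blast
qed

text \<open>The prepended \<open>p\<close> shifts indices by one, so \<open>(p # xs) ! i\<close> is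
  the row below row \<open>i\<close>.\<close>

lemma stretch_from_concat:
  "stretch_from p xs = concat (map (\<lambda>i. replicate (if xs ! i < (p # xs) ! i \<and>
     rises (xs ! i) (drop (Suc i) xs) then 3 else 1) (xs ! i)) [0..<length xs])"
proof (induction xs arbitrary: p)
  case (Cons x xs)
  show ?case unfolding length_Cons upt_conv_Cons[OF zero_less_Suc] map_Suc_upt[symmetric]
    by (auto simp: Cons[of x] comp_def numeral_3_eq_3)
qed simp

text \<open>At \<open>i = 0\<close> the test \<open>a ! 0 < 0\<close> fails, in agreement with
  \<open>1 \<le> i\<close> in \<open>is_well\<close>.\<close>

lemma stretch_rows_eq: "stretch_rows a = stretch_from 0 a"
  unfolding stretch_rows_def stretch_from_concat is_well_iff
  by (intro arg_cong[of _ _ concat] map_cong refl) (auto simp: nth_Cons split: nat.split)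

text \<open>Wells of height one and two are visible in windows of three and four consecutive rows.
  This local form carries over to row lengths indexed by integers.\<close>

lemma wide_from_nth:
  "wide_from p xs \<longleftrightarrow> (\<forall>i. let l = p # xs in
     (i + 2 < length l \<longrightarrow> \<not> (l ! (i + 1) < l ! i \<and> l ! (i + 1) < l ! (i + 2))) \<and>
     (i + 3 < length l \<longrightarrow> \<not> (l ! (i + 1) < l ! i \<and> l ! (i + 2) = l ! (i + 1) \<and> l ! (i + 2) < l ! (i + 3))))"
proof (induction xs arbitrary: p)
  case (Cons x xs)
  have all: "(\<forall>i. P i) \<longleftrightarrow> P 0 \<and> (\<forall>i. P (Suc i))" for P :: "nat \<Rightarrow> bool"
    by (metis not0_implies_Suc)
  have local: "(x < p \<and> rises x xs \<longrightarrow> (\<exists>zs. xs = x # x # zs)) \<longleftrightarrow>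
     (0 < length xs \<longrightarrow> \<not> (x < p \<and> x < xs ! 0)) \<and>
     (1 < length xs \<longrightarrow> \<not> (x < p \<and> xs ! 0 = x \<and> x < xs ! 1))"
    by (cases xs; cases "tl xs") auto
  show ?case unfolding wide_from.simps local Cons
    by (subst (2) all) (auto simp: Let_def numeral_2_eq_2 numeral_3_eq_3)
qed simp

section \<open>Envelopes as zigzags\<close>

definition row_len :: "int \<Rightarrow> nat list \<Rightarrow> int \<Rightarrow> int" where
  "row_len b a y = (if b \<le> y \<and> y < b + int (length a) then int (a ! nat (y - b)) else 0)"

lemma mem_bar_cells: "(x, y) \<in> bar_cells c b a \<longleftrightarrow> c - row_len b a y < x \<and> x \<le> c"
proof
  assume "c - row_len b a y < x \<and> x \<le> c"
  then show "(x, y) \<in> bar_cells c b a"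
    by (auto simp: bar_cells_def row_len_def intro!: exI[of _ "nat (y - b)"] split: if_splits)
qed (auto simp: bar_cells_def row_len_def)

lemma row_len_nonneg: "0 \<le> row_len b a y"
  by (simp add: row_len_def)

lemma row_len_pos:
  assumes "0 \<notin> set a"
  shows "1 \<le> row_len b a y \<longleftrightarrow> b \<le> y \<and> y < b + int (length a)"
proof (cases "b \<le> y \<and> y < b + int (length a)")
  case True
  then have "a ! nat (y - b) \<in> set a" by (intro nth_mem) linarith
  then have "a ! nat (y - b) \<noteq> 0" using assms by metis
  then show ?thesis using True by (simp add: row_len_def)
qed (auto simp: row_len_def)

text \<open>Since \<open>1 \<le> w\<close>, the value is not the default \<open>0\<close> outside
  the list.\<close>

lemma range_row_len:
  assumes "1 \<le> w"
  shows "(\<exists>y. row_len b a y = int w) \<longleftrightarrow> w \<in> set a"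
proof
  assume "\<exists>y. row_len b a y = int w"
  then obtain y where "b \<le> y" "y < b + int (length a)" "a ! nat (y - b) = w"
    using assms by (auto simp: row_len_def split: if_splits)
  then show "w \<in> set a" by (auto simp: in_set_conv_nth intro!: exI[of _ "nat (y - b)"])
next
  assume "w \<in> set a"
  then obtain i where "i < length a" "a ! i = w" by (auto simp: in_set_conv_nth)
  then have "row_len b a (b + int i) = int w" by (simp add: row_len_def)
  then show "\<exists>y. row_len b a y = int w" ..
qed

lemma Max_row_len:
  assumes "a \<noteq> []" "1 \<le> w"
  shows "Max (set a) = w \<longleftrightarrow> (\<forall>y. row_len b a y \<le> int w) \<and> (\<exists>y. row_len b a y = int w)"
proof -
  have "(\<forall>y. row_len b a y \<le> int w) \<longleftrightarrow> (\<forall>k \<in> set a. k \<le> w)"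
  proof
    assume le: "\<forall>y. row_len b a y \<le> int w"
    show "\<forall>k \<in> set a. k \<le> w"
    proof
      fix k assume "k \<in> set a"
      then obtain i where "i < length a" "a ! i = k" by (auto simp: in_set_conv_nth)
      then have "row_len b a (b + int i) = int k" by (simp add: row_len_def)
      with le show "k \<le> w" by (metis of_nat_le_iff)
    qed
  qed (auto simp: row_len_def)
  then show ?thesis using assms range_row_len[of w b a] by (simp add: Max_eq_iff) blast
qed

lemma row_len_of_function:
  assumes "s \<le> t" "\<And>y. y < s \<or> t < y \<Longrightarrow> L y = 0" "\<And>y. 0 \<le> L y"
  shows "row_len s (map (\<lambda>y. nat (L y)) [s..t]) = L"
  using assms by (intro ext) (auto simp: row_len_def)

section \<open>Parameters and envelope of a bargraph\<close>

lemma bar_cells_finite: "finite (bar_cells c b a)"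
proof -
  have "bar_cells c b a = (\<Union>i<length a. {c - int (a ! i)<..c} \<times> {b + int i})"
    by (auto simp: bar_cells_def)
  then show ?thesis by simp
qed

context
  fixes a :: "nat list"
  assumes ne: "a \<noteq> []" and pos: "0 \<notin> set a"
begin

lemma snd_bar_cells: "snd ` bar_cells c b a = {b..b + int (length a) - 1}"
proof -
  have "y \<in> snd ` bar_cells c b a \<longleftrightarrow> 1 \<le> row_len b a y" for y
  proof
    assume "1 \<le> row_len b a y"
    then have "(c, y) \<in> bar_cells c b a" by (simp add: mem_bar_cells)
    then show "y \<in> snd ` bar_cells c b a" by force
  qed (auto simp: mem_bar_cells)
  then show ?thesis using row_len_pos[OF pos] by (intro set_eqI) simp
qed

lemma right_column_bar_cells: "right_column (bar_cells c b a) = c"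
proof -
  have "1 \<le> row_len b a b" using row_len_pos[OF pos] ne by simp
  then have "(c, b) \<in> bar_cells c b a" by (simp add: mem_bar_cells)
  then show ?thesis unfolding right_column_def
    by (intro Max_eqI) (auto simp: bar_cells_finite mem_bar_cells image_iff intro!: bexI[of _ "(c, b)"])
qed

lemma bottom_row_bar_cells: "bottom_row (bar_cells c b a) = b"
  unfolding bottom_row_def snd_bar_cells using ne by (intro Min_eqI) (auto simp: Suc_le_eq)

lemma top_row_bar_cells: "top_row (bar_cells c b a) = b + int (length a) - 1"
  unfolding top_row_def snd_bar_cells using ne by (intro Max_eqI) (auto simp: Suc_le_eq)

lemma row_lengths_bar_cells: "row_lengths (bar_cells c b a) = a"
proof (rule nth_equalityI)
  show "length (row_lengths (bar_cells c b a)) = length a"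
    by (simp add: row_lengths_def bottom_row_bar_cells top_row_bar_cells)
  fix i assume "i < length (row_lengths (bar_cells c b a))"
  then have i: "i < length a"
    by (simp add: row_lengths_def bottom_row_bar_cells top_row_bar_cells)
  have "{x. (x, y) \<in> bar_cells c b a} = {c - row_len b a y<..c}" for y
    by (auto simp: mem_bar_cells)
  then show "row_lengths (bar_cells c b a) ! i = a ! i"
    using i by (simp add: row_lengths_def bottom_row_bar_cells top_row_bar_cells row_len_def)
qed

lemma stretched_bar_cells: "stretched (bar_cells c b a) = bar_cells c b (stretch_rows a)"
  by (simp add: stretched_def right_column_bar_cells bottom_row_bar_cells row_lengths_bar_cells)

text \<open>In terms of the distance \<open>c - x\<close>, row \<open>y'\<close> fills
  \<open>0\<close> to \<open>L y' - 1\<close>, and contact reaches one further. The condition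
  \<open>1 \<le> L y'\<close> stops an empty row from counting as contact at distance
  \<open>0\<close>.\<close>

lemma mem_envelope_bar_cells:
  fixes b :: int
  defines "L \<equiv> row_len b a"
  shows "(x, y) \<in> envelope (bar_cells c b a) \<longleftrightarrow>
    L y \<le> c - x \<and> (\<exists>y' \<in> {y - 1..y + 1}. 1 \<le> L y' \<and> c - x \<le> L y')"
proof
  assume "(x, y) \<in> envelope (bar_cells c b a)"
  then obtain x' y' where "\<not> (c - L y < x \<and> x \<le> c)" "x \<le> c" "c - L y' < x'" "x' \<le> c"
    "\<bar>x - x'\<bar> \<le> 1" "\<bar>y - y'\<bar> \<le> 1"
    by (auto simp: envelope_def right_column_bar_cells mem_bar_cells L_def)
  then show "L y \<le> c - x \<and> (\<exists>y' \<in> {y - 1..y + 1}. 1 \<le> L y' \<and> c - x \<le> L y')"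
    by (intro conjI bexI[of _ y']) auto
next
  assume r: "L y \<le> c - x \<and> (\<exists>y' \<in> {y - 1..y + 1}. 1 \<le> L y' \<and> c - x \<le> L y')"
  then obtain y' where y': "y' \<in> {y - 1..y + 1}" "1 \<le> L y'" "c - x \<le> L y'" by blast
  have "0 \<le> L y" by (simp add: L_def row_len_nonneg)
  \<comment> \<open>The cell one column to the right, or the last column if \<open>x\<close> already
    lies there.\<close>
  define x' where "x' = min c (x + 1)"
  have "(x', y') \<in> bar_cells c b a" "\<bar>x - x'\<bar> \<le> 1" "\<bar>y - y'\<bar> \<le> 1" "x \<le> c"
    using y' r \<open>0 \<le> L y\<close> by (auto simp: mem_bar_cells L_def x'_def)
  then show "(x, y) \<in> envelope (bar_cells c b a)"
    using r unfolding envelope_def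
    by (auto simp: right_column_bar_cells mem_bar_cells L_def)
qed

end

section \<open>Short wells and the shape of the envelope\<close>

definition no_short_wells :: "(int \<Rightarrow> int) \<Rightarrow> bool" where
  "no_short_wells L \<longleftrightarrow> (\<forall>y. \<not> (L y < L (y - 1) \<and> L y < L (y + 1)) \<and>
     \<not> (L y < L (y - 1) \<and> L (y + 1) = L y \<and> L (y + 1) < L (y + 2)))"

text \<open>In row \<open>y\<close> both sets reach out to the longest of the three rows
  \<open>y - 1\<close>, \<open>y\<close>, \<open>y + 1\<close>. The zigzag starts at distance
  \<open>max (L y) (min (L (y - 1)) (L (y + 1)))\<close>, the envelope at \<open>L y\<close>; these
  agree when row \<open>y\<close> is no well of height one.\<close>

lemma envelope_zigzag:
  assumes "a \<noteq> []" "0 \<notin> set a" "no_short_wells (row_len b a)"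
  shows "envelope (bar_cells c b a) =
    zigzag (\<lambda>y. c - max (row_len b a (y - 1)) (row_len b a y)) (b - 1) (b + int (length a))"
proof -
  define L where "L = row_len b a"
  have L: "0 \<le> L y" for y by (simp add: L_def row_len_nonneg)
  have "(x, y) \<in> envelope (bar_cells c b a) \<longleftrightarrow>
      (x, y) \<in> zigzag (\<lambda>y. c - max (L (y - 1)) (L y)) (b - 1) (b + int (length a))" for x y
  proof -
    have near: "{y - 1..y + 1} = {y - 1, y, y + 1}" by auto
    have rows: "b - 1 \<le> y \<and> y \<le> b + int (length a) \<longleftrightarrow> 1 \<le> L (y - 1) \<or> 1 \<le> L y \<or> 1 \<le> L (y + 1)"
      using assms(1) unfolding L_def row_len_pos[OF assms(2)]
      by (cases a) auto
    have "\<not> (L y < L (y - 1) \<and> L y < L (y + 1))"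
      using assms(3) by (auto simp: no_short_wells_def L_def)
    then show ?thesis
      using rows L[of y] L[of "y - 1"] L[of "y + 1"]
      unfolding mem_envelope_bar_cells[OF assms(1,2)] L_def[symmetric] near zigzag_def
      by (simp add: min_def max_def) linarith
  qed
  then show ?thesis unfolding L_def by auto
qed

text \<open>The larger of \<open>L (y - 1)\<close> and \<open>L y\<close> also bounds the maximum at
  \<open>y - 1\<close> or at \<open>y + 1\<close> from below, so the maxima have no strict peak. At
  a strict dip, \<open>L (y - 2)\<close> and \<open>L (y + 1)\<close> both exceed
  \<open>L (y - 1)\<close> and \<open>L y\<close>, which leaves a well of height one or two.\<close>

lemma tame_max:
  assumes "no_short_wells L"
  shows "tame (\<lambda>y. c - max (L (y - 1)) (L y)) s t"
  unfolding tame_def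
proof (intro allI impI)
  fix y
  have "\<not> (L y < L (y - 1) \<and> L y < L (y + 1))" "\<not> (L (y - 1) < L (y - 2) \<and> L (y - 1) < L y)"
    "\<not> (L (y - 1) < L (y - 2) \<and> L y = L (y - 1) \<and> L y < L (y + 1))"
    using assms[unfolded no_short_wells_def, rule_format, of y]
      assms[unfolded no_short_wells_def, rule_format, of "y - 1"]
    by (auto simp: add.commute)
  then show "\<not> (c - max (L (y - 1 - 1)) (L (y - 1)) < c - max (L (y - 1)) (L y) \<and>
             c - max (L (y + 1 - 1)) (L (y + 1)) < c - max (L (y - 1)) (L y)) \<and>
          \<not> (c - max (L (y - 1)) (L y) < c - max (L (y - 1 - 1)) (L (y - 1)) \<and>
             c - max (L (y - 1)) (L y) < c - max (L (y + 1 - 1)) (L (y + 1)))"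
    by (simp add: max_def) linarith
qed

lemma wide_from_iff: "wide_from 0 a \<longleftrightarrow> no_short_wells (row_len b a)"
proof -
  define L where "L = row_len b a"
  have L: "0 \<le> L y" for y by (simp add: L_def row_len_nonneg)
  have out: "b \<le> y \<and> y < b + int (length a)" if "0 < L y" for y
    using that by (auto simp: L_def row_len_def split: if_splits)
  \<comment> \<open>The prepended \<open>0\<close> is the empty row \<open>b - 1\<close>.\<close>
  have nth: "int ((0 # a) ! i) = L (b - 1 + int i)" if "i < length (0 # a)" for i
    using that by (cases i) (auto simp: L_def row_len_def)
  have lt: "(0 # a) ! i < (0 # a) ! j \<longleftrightarrow> L (b - 1 + int i) < L (b - 1 + int j)"
    "(0 # a) ! i = (0 # a) ! j \<longleftrightarrow> L (b - 1 + int i) = L (b - 1 + int j)"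
    if "i < length (0 # a)" "j < length (0 # a)" for i j
    using nth[OF that(1)] nth[OF that(2)] by linarith+
  let ?P = "\<lambda>y. L y < L (y - 1) \<and> L y < L (y + 1)"
  let ?Q = "\<lambda>y. L y < L (y - 1) \<and> L (y + 1) = L y \<and> L (y + 1) < L (y + 2)"
  have "wide_from 0 a \<longleftrightarrow> (\<forall>i. (i + 2 < length (0 # a) \<longrightarrow> \<not> ?P (b + int i)) \<and>
      (i + 3 < length (0 # a) \<longrightarrow> \<not> ?Q (b + int i)))"
    unfolding wide_from_nth Let_def
    by (intro all_cong1 conj_cong imp_cong refl arg_cong[of _ _ Not])
       (subst lt; simp add: algebra_simps)+
  also have "\<dots> \<longleftrightarrow> (\<forall>y. \<not> ?P y \<and> \<not> ?Q y)"
  proof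
    assume l: "\<forall>i. (i + 2 < length (0 # a) \<longrightarrow> \<not> ?P (b + int i)) \<and>
      (i + 3 < length (0 # a) \<longrightarrow> \<not> ?Q (b + int i))"
    show "\<forall>y. \<not> ?P y \<and> \<not> ?Q y"
    proof
      fix y
      \<comment> \<open>The larger side of a strict inequality is positive and hence a row of the
        bargraph, so short wells occur only within the list.\<close>
      have "b + 1 \<le> y" if "L y < L (y - 1)" using out[of "y - 1"] L[of y] that by auto
      moreover have "y + 1 < b + int (length a)" if "L y < L (y + 1)"
        using out[of "y + 1"] L[of y] that by auto
      moreover have "y + 2 < b + int (length a)" if "L (y + 1) < L (y + 2)"
        using out[of "y + 2"] L[of "y + 1"] that by auto
      ultimately show "\<not> ?P y \<and> \<not> ?Q y" using l[rule_format, of "nat (y - b)"] by auto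
    qed
  qed blast
  finally show ?thesis unfolding no_short_wells_def L_def .
qed

section \<open>Bubbles as tame zigzags\<close>

lemma bubble_zigzag:
  assumes tame: "tame D s t" and ends: "D s = c" "D (t + 1) = c"
    and range: "\<And>y. s < y \<Longrightarrow> y \<le> t \<Longrightarrow> c - int w \<le> D y \<and> D y < c"
    and width: "s < m" "m \<le> t" "D m = c - int w" and "1 \<le> w"
  shows "bubble (w + 1) (zigzag D s t)"
proof -
  obtain xs where xs: "xs \<noteq> []" "hd xs = (c, s)" "last xs = (c, t)" "set xs = zigzag D s t"
    "successively new_step xs" "induced_path xs"
    using zigzag_listing[OF _ tame] width ends by auto
  have "snake (zigzag D s t)" using induced_path_snake[OF xs(6,1)] xs(4) by simp
  moreover have list: "directed_listing (zigzag D s t) xs"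
    using xs induced_path_distinct[OF xs(6)] by (simp add: directed_listing_def)
  moreover have "fst p \<in> {c - int w..c - 1}" if p: "p \<in> zigzag D s t - {(c, s), (c, t)}" for p
  proof -
    obtain x y where xy: "p = (x, y)" by (cases p)
    then have y: "s \<le> y" "y \<le> t" "min (D y) (D (y + 1)) \<le> x" "x \<le> max (D y) (D (y + 1))"
      and "\<not> (x = c \<and> (y = s \<or> y = t))"
      using p by (auto simp: zigzag_def)
    \<comment> \<open>Only the entry of row \<open>s\<close> and the exit of row \<open>t\<close>
      are in column \<open>c\<close>; these are tail and head.\<close>
    moreover have "y = s \<or> s < y" "y = t \<or> y < t" using y by auto
    ultimately show ?thesis using xy range[of y] range[of "y + 1"] ends width by auto
  qed
  moreover have "(c - int w, m) \<in> zigzag D s t" using width by (auto simp: zigzag_def)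
  ultimately show ?thesis using xs unfolding bubble_def partially_directed_snake_def
    by (intro conjI exI[of _ xs] exI[of _ c]) (auto intro!: bexI[of _ "(c - int w, m)"])
qed

lemma bubble_is_zigzag:
  assumes "bubble (w + 1) S" "1 \<le> w"
  shows "\<exists>D s t c m. S = zigzag D s t \<and> tame D s t \<and> D s = c \<and> D (t + 1) = c \<and>
    (\<forall>y. s < y \<and> y \<le> t \<longrightarrow> c - int w \<le> D y \<and> D y < c) \<and> s < m \<and> m \<le> t \<and> D m = c - int w"
proof -
  from assms(1) obtain xs c where snake: "snake S" and xs: "directed_listing S xs"
    and c: "fst (hd xs) = c" "fst (last xs) = c"
    and range: "\<And>p. p \<in> S - {hd xs, last xs} \<Longrightarrow> fst p \<in> {c - int w..c - 1}"
    and ex: "\<exists>p \<in> S. fst p = c - int w"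
    unfolding bubble_def partially_directed_snake_def by auto
  obtain D s t where D: "s \<le> t" "hd xs = (D s, s)" "last xs = (D (t + 1), t)" "S = zigzag D s t"
    using listing_zigzag[of xs] xs unfolding directed_listing_def by auto
  have ends: "D s = c" "D (t + 1) = c" using D c by auto
  have tame: "tame D s t" using snake_zigzag_tame snake D(4) by simp
  obtain px py where p: "(px, py) \<in> zigzag D s t" "px = c - int w" using ex D(4) by auto
  have r: "c - int w \<le> D y \<and> D y < c" if y: "s < y" "y \<le> t" for y
  proof -
    \<comment> \<open>The path passes from row \<open>y - 1\<close> to row \<open>y\<close> through
      these two cells. Unless they are exactly tail and head, one of them is subject to the column
      bounds.\<close>
    have mem: "(D y, y - 1) \<in> S" "(D y, y) \<in> S" using y D(4) by (auto simp: zigzag_def)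
    show ?thesis
    proof (cases "D y = c \<and> y - 1 = s \<and> y = t")
      case True \<comment> \<open>the bubble would consist of tail and head only\<close>
      then have "s = t - 1" by simp
      then have "D (t - 1) = c" "D t = c" "D (t + 1) = c" using ends True by auto
      moreover have "py = t - 1 \<or> py = t" using p(1) \<open>s = t - 1\<close> by (auto simp: zigzag_def)
      ultimately show ?thesis using p assms(2) by (auto simp: zigzag_def)
    next
      case False
      then have "(D y, y - 1) \<in> S - {hd xs, last xs} \<or> (D y, y) \<in> S - {hd xs, last xs}"
        using mem D ends y by auto
      then show ?thesis using range[of "(D y, y - 1)"] range[of "(D y, y)"] by auto
    qed
  qed
  \<comment> \<open>A leftmost cell must be an end of its row, and not one of the two ends in column
    \<open>c\<close>, because \<open>1 \<le> w\<close>.\<close>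
  have "s < py \<and> D py = c - int w \<or> py < t \<and> D (py + 1) = c - int w"
  proof -
    have py: "s \<le> py" "py \<le> t" "min (D py) (D (py + 1)) \<le> px" using p by (auto simp: zigzag_def)
    moreover have "py = s \<or> s < py" "py = t \<or> py < t" using py by auto
    ultimately show ?thesis using p(2) assms(2) ends r[of py] r[of "py + 1"] by auto
  qed
  moreover have "s \<le> py" "py \<le> t" using p(1) by (auto simp: zigzag_def)
  ultimately have "\<exists>m. s < m \<and> m \<le> t \<and> D m = c - int w"
    by (metis add1_zle_eq zless_add1_eq le_less_trans order_le_less)
  then show ?thesis using D(4) tame ends r by blast
qed

section \<open>Bijection on translation classes\<close>

lemma mem_translate: "(x, y) \<in> translate u v S \<longleftrightarrow> (x - u, y - v) \<in> S"
  by (force simp: translate_def)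

lemma equiv_translation_rel: "equiv UNIV translation_rel"
proof (rule equivI)
  have "translate 0 0 S = S" for S by (auto simp: translate_def)
  then show "refl translation_rel" unfolding refl_on_def translation_rel_def by (auto intro: sym)
  have inv: "translate (- u) (- v) (translate u v S) = S" for u v S
    by (auto simp: mem_translate)
  show "sym translation_rel" unfolding sym_def translation_rel_def using inv by fastforce
  have "translate u v (translate u' v' S) = translate (u + u') (v + v') S" for u v u' v' S
    by (auto simp: mem_translate algebra_simps)
  then show "trans translation_rel" unfolding trans_def translation_rel_def by blast
qed simp

lemma row_len_shift: "row_len (b + v) a y = row_len b a (y - v)"
  by (auto simp: row_len_def algebra_simps)

lemma translate_bar_cells: "translate u v (bar_cells c b a) = bar_cells (c + u) (b + v) a"
  by (auto simp: mem_translate mem_bar_cells row_len_shift)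

text \<open>Classes are subsets of \<open>A\<close>, on which \<open>F\<close> is injective, so
  their images determine them; by \<open>eqv\<close> these images are whole classes.\<close>

lemma bij_betw_quotient:
  assumes "equiv UNIV r" and bij: "bij_betw F A B"
    and closed: "\<And>P. P \<in> A \<Longrightarrow> r `` {P} \<subseteq> A"
    and eqv: "\<And>P. P \<in> A \<Longrightarrow> F ` (r `` {P}) = r `` {F P}"
  shows "bij_betw ((`) F) (A // r) (B // r)"
proof (rule bij_betw_imageI)
  have sub: "C \<subseteq> A" if "C \<in> A // r" for C using that closed by (auto elim!: quotientE)
  show "inj_on ((`) F) (A // r)"
    using bij_betw_imp_inj_on[OF bij] sub by (auto simp: inj_on_def inj_on_image_eq_iff)
  have B: "B = F ` A" using bij by (simp add: bij_betw_def)
  show "(`) F ` (A // r) = B // r"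
    unfolding B by (auto simp: quotient_def eqv image_iff)
qed

section \<open>Recovering a bargraph from its envelope\<close>

text \<open>If row \<open>y\<close> were longer in the second bargraph, its envelope cell just past
  that row would also touch a row of the first one near \<open>y\<close>. That row makes the cell
  just past row \<open>y\<close> of the first bargraph an envelope cell too, yet it lies inside the
  second bargraph.\<close>

lemma row_len_envelope:
  assumes "a \<noteq> []" "0 \<notin> set a" "a' \<noteq> []" "0 \<notin> set a'"
    and eq: "envelope (bar_cells c b a) = envelope (bar_cells c b' a')"
  shows "row_len b' a' y \<le> row_len b a y"
proof -
  let ?L = "row_len b a" and ?L' = "row_len b' a'"
  have L: "0 \<le> ?L z" "0 \<le> ?L' z" for z by (simp_all add: row_len_nonneg)
  have mem: "(x, y) \<in> envelope (bar_cells c b a) \<longleftrightarrow> (x, y) \<in> envelope (bar_cells c b' a')" for x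
    by (simp add: eq)
  note iff = mem[unfolded mem_envelope_bar_cells[OF assms(1,2)] mem_envelope_bar_cells[OF assms(3,4)]]
  show ?thesis
  proof (rule ccontr)
    assume "\<not> ?L' y \<le> ?L y"
    then have less: "?L y < ?L' y" by simp
    then have "\<exists>y' \<in> {y - 1..y + 1}. 1 \<le> ?L' y' \<and> ?L' y \<le> ?L' y'"
      using L(1)[of y] by (intro bexI[of _ y]) auto
    then obtain y' where "y' \<in> {y - 1..y + 1}" "1 \<le> ?L y'" "?L' y \<le> ?L y'"
      using iff[of "c - ?L' y"] by auto
    then have "\<exists>y' \<in> {y - 1..y + 1}. 1 \<le> ?L y' \<and> ?L y \<le> ?L y'" using less by force
    then show False using iff[of "c - ?L y"] less by auto
  qed
qed

lemma envelope_right_column: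
  assumes "a \<noteq> []" "0 \<notin> set a"
  shows "(c, b - 1) \<in> envelope (bar_cells c b a)"
    and "(x, y) \<in> envelope (bar_cells c b a) \<Longrightarrow> x \<le> c"
proof -
  have "1 \<le> row_len b a b" using row_len_pos[OF assms(2)] assms(1) by simp
  moreover have "row_len b a (b - 1) = 0" by (simp add: row_len_def)
  ultimately show "(c, b - 1) \<in> envelope (bar_cells c b a)"
    unfolding mem_envelope_bar_cells[OF assms] by (auto intro!: bexI[of _ b])
  show "(x, y) \<in> envelope (bar_cells c b a) \<Longrightarrow> x \<le> c"
    unfolding mem_envelope_bar_cells[OF assms] using row_len_nonneg[of b a y] by auto
qed

text \<open>The rightmost column of the envelope gives \<open>c\<close>; comparing row lengths both
  ways gives equal cell sets, from which \<open>b\<close> and \<open>a\<close> are read off.\<close>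

lemma envelope_inject:
  assumes "a \<noteq> []" "0 \<notin> set a" "a' \<noteq> []" "0 \<notin> set a'"
    and eq: "envelope (bar_cells c b a) = envelope (bar_cells c' b' a')"
  shows "c = c'" "b = b'" "a = a'"
proof -
  note E = envelope_right_column[OF assms(1,2)] and E' = envelope_right_column[OF assms(3,4)]
  show c: "c = c'" using E(1)[of c b] E(2) E'(1)[of c' b'] E'(2) eq by (metis order_antisym)
  have "row_len b a = row_len b' a'"
    using row_len_envelope[OF assms(1-4)] row_len_envelope[OF assms(3,4,1,2)] eq c
    by (intro ext order_antisym) metis+
  then have cells: "bar_cells c b a = bar_cells c' b' a'" using c by (auto simp: mem_bar_cells)
  show "b = b'"
    using arg_cong[OF cells, of bottom_row] assms by (simp add: bottom_row_bar_cells)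
  show "a = a'"
    using arg_cong[OF cells, of row_lengths] assms by (simp add: row_lengths_bar_cells)
qed

lemma stretch_rows_simps:
  "set (stretch_rows a) = set a" "stretch_rows a = [] \<longleftrightarrow> a = []"
  by (auto simp: stretch_rows_eq set_stretch_from) (metis set_empty set_stretch_from)+

lemma stretch_rows_inject: "stretch_rows a = stretch_rows a' \<Longrightarrow> a = a'"
  by (metis stretch_rows_eq unstretch_stretch)

lemma bargraphs_iff:
  "P \<in> bargraphs w \<longleftrightarrow> (\<exists>c b a. P = bar_cells c b a \<and> a \<noteq> [] \<and> 0 \<notin> set a \<and> Max (set a) = w)"
  unfolding bargraphs_def by (auto simp: Suc_le_eq) (metis gr0I)+

lemma envelope_stretched:
  assumes "a \<noteq> []" "0 \<notin> set a"
  shows "envelope (stretched (bar_cells c b a)) = envelope (bar_cells c b (stretch_rows a))"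
  using assms by (simp add: stretched_bar_cells)

section \<open>From bargraphs to bubbles and back\<close>

lemma envelope_stretched_bubble:
  assumes "P \<in> bargraphs w" "1 \<le> w"
  shows "bubble (w + 1) (envelope (stretched P))"
proof -
  obtain c b a0 where P: "P = bar_cells c b a0" "a0 \<noteq> []" "0 \<notin> set a0" "Max (set a0) = w"
    using assms(1) bargraphs_iff by metis
  define a where "a = stretch_rows a0"
  have a: "a \<noteq> []" "0 \<notin> set a" "Max (set a) = w" using P by (simp_all add: a_def stretch_rows_simps)
  define L where "L = row_len b a"
  have wells: "no_short_wells L"
    using wide_stretch_from[of 0 a0] by (simp add: wide_from_iff[of _ b] L_def a_def stretch_rows_eq)
  have le: "L y \<le> int w" for y using Max_row_len[OF a(1) assms(2)] a(3) L_def by blast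
  obtain m where m: "L m = int w" using Max_row_len[OF a(1) assms(2)] a(3) L_def by blast
  have in_rows: "1 \<le> L y \<longleftrightarrow> b \<le> y \<and> y < b + int (length a)" for y
    unfolding L_def by (rule row_len_pos[OF a(2)])
  have out: "L y = 0" if "y < b \<or> b + int (length a) \<le> y" for y using that by (auto simp: L_def row_len_def)
  have m_in: "b \<le> m" "m < b + int (length a)" using in_rows[of m] m assms(2) by auto
  let ?D = "\<lambda>y. c - max (L (y - 1)) (L y)"
  have "bubble (w + 1) (zigzag ?D (b - 1) (b + int (length a)))"
  proof (rule bubble_zigzag[where m = m and c = c])
    show "tame ?D (b - 1) (b + int (length a))" by (rule tame_max[OF wells])
    show "?D (b - 1) = c" "?D (b + int (length a) + 1) = c" by (simp_all add: out)
    fix y assume "b - 1 < y" "y \<le> b + int (length a)"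
    \<comment> \<open>The path enters row \<open>b + int (length a)\<close> too, beside the top row
      of the bargraph, hence the alternative \<open>y - 1\<close>.\<close>
    then have "1 \<le> L (y - 1) \<or> 1 \<le> L y" unfolding in_rows using m_in by auto
    then show "c - int w \<le> ?D y \<and> ?D y < c" using le[of y] le[of "y - 1"] by auto
  qed (use m m_in le[of "m - 1"] assms(2) in auto)
  then show ?thesis
    using envelope_zigzag[OF a(1,2), of b c] wells envelope_stretched[OF P(2,3)] P(1)
    by (simp add: L_def a_def)
qed

lemma bubble_is_envelope:
  assumes "bubble (w + 1) S" "1 \<le> w"
  shows "\<exists>P \<in> bargraphs w. envelope (stretched P) = S"
proof -
  obtain D s t c m where S: "S = zigzag D s t" and tame: "tame D s t" and ends: "D s = c" "D (t + 1) = c"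
    and range: "\<And>y. s < y \<Longrightarrow> y \<le> t \<Longrightarrow> c - int w \<le> D y \<and> D y < c"
    and m: "s < m" "m \<le> t" "D m = c - int w"
    using bubble_is_zigzag[OF assms] by blast
  \<comment> \<open>Distance of the entry column from the line, extended by \<open>0\<close>. At
    \<open>s\<close> and \<open>t + 1\<close> this default agrees with \<open>D = c\<close>.\<close>
  define E where "E y = (if s < y \<and> y \<le> t then c - D y else 0)" for y
  define L where "L y = min (E y) (E (y + 1))" for y
  have E_pos: "1 \<le> E y \<longleftrightarrow> s < y \<and> y \<le> t" and E_nonneg: "0 \<le> E y" and E_le: "E y \<le> int w" for y
    using range[of y] by (auto simp: E_def)
  have E_D: "D y = c - E y" if "s \<le> y" "y \<le> t + 1" for y
  proof -
    have "y = s \<or> y = t + 1 \<or> s < y \<and> y \<le> t" using that by auto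
    then show ?thesis using ends by (auto simp: E_def)
  qed
  have peak: "\<not> (E (y - 1) < E y \<and> E (y + 1) < E y)"
    and dip: "\<not> (E y < E (y - 1) \<and> E y < E (y + 1))" for y
  proof -
    \<comment> \<open>Outside the interior, \<open>E y\<close> and one neighbouring value vanish,
      which rules out both kinds of extremum; inside, tameness applies.\<close>
    have "E y = 0 \<and> (E (y - 1) = 0 \<or> E (y + 1) = 0) \<or> s < y \<and> y \<le> t"
      using m by (auto simp: E_def)
    moreover have "\<not> (E (y - 1) < E y \<and> E (y + 1) < E y) \<and> \<not> (E y < E (y - 1) \<and> E y < E (y + 1))"
      if "s < y" "y \<le> t"
      using tame[unfolded tame_def, rule_format, of y] that E_D[of y] E_D[of "y - 1"] E_D[of "y + 1"]
      by auto
    ultimately show "\<not> (E (y - 1) < E y \<and> E (y + 1) < E y)"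
      "\<not> (E y < E (y - 1) \<and> E y < E (y + 1))"
      using E_nonneg[of y] E_nonneg[of "y - 1"] E_nonneg[of "y + 1"] by auto
  qed
  \<comment> \<open>The left side equals \<open>min (E y) (max (E (y - 1)) (E (y + 1)))\<close>,
    which is \<open>E y\<close> without a strict peak.\<close>
  have max_L: "max (L (y - 1)) (L y) = E y" for y using peak[of y] by (auto simp: L_def)
  have L_pos: "1 \<le> L y \<longleftrightarrow> s + 1 \<le> y \<and> y \<le> t - 1" for y
    using E_pos[of y] E_pos[of "y + 1"] by (auto simp: L_def)
  have L_nonneg: "0 \<le> L y" for y using E_nonneg by (simp add: L_def)
  have L_le: "L y \<le> int w" for y using E_le[of y] by (simp add: L_def)
  have m_L: "L (m - 1) = int w \<or> L m = int w"
  proof -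
    have "E m = int w" using m by (simp add: E_def)
    then show ?thesis using max_L[of m] by linarith
  qed
  then have st: "s + 1 \<le> t - 1" using L_pos[of m] L_pos[of "m - 1"] assms(2) by auto
  \<comment> \<open>If \<open>L y < L (y - 1)\<close>, then \<open>L y = E (y + 1)\<close>, so
    \<open>L (y + 1)\<close> is not larger. A well of height two would make \<open>E (y + 1)\<close>
    a strict dip.\<close>
  have wells: "no_short_wells L"
    unfolding no_short_wells_def
  proof
    fix y
    show "\<not> (L y < L (y - 1) \<and> L y < L (y + 1)) \<and>
      \<not> (L y < L (y - 1) \<and> L (y + 1) = L y \<and> L (y + 1) < L (y + 2))"
      using dip[of "y + 1"] by (auto simp: L_def min_def add.assoc split: if_splits)
  qed
  define a0 where "a0 = map (\<lambda>y. nat (L y)) [s + 1..t - 1]"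
  define a where "a = unstretch_from 0 a0"
  have L: "row_len (s + 1) a0 = L" unfolding a0_def
  proof (rule row_len_of_function[OF st _ L_nonneg])
    fix y assume "y < s + 1 \<or> t - 1 < y"
    then show "L y = 0" using L_pos[of y] L_nonneg[of y] by linarith
  qed
  have "stretch_rows a = a0"
    using stretch_unstretch[of 0 a0] wells L wide_from_iff[of a0 "s + 1"]
    by (simp add: stretch_rows_eq a_def)
  moreover have a0: "a0 \<noteq> []" using st by (simp add: a0_def)
  moreover have a0_pos: "0 \<notin> set a0"
  proof
    assume "0 \<in> set a0"
    then obtain y where "s + 1 \<le> y" "y \<le> t - 1" "L y \<le> 0" by (auto simp: a0_def)
    then show False using L_pos[of y] by auto
  qed
  moreover have "Max (set a0) = w"
    using Max_row_len[OF a0 assms(2), of "s + 1"] L L_le m_L by auto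
  ultimately have a: "a \<noteq> []" "0 \<notin> set a" "Max (set a) = w" "stretch_rows a = a0"
    using stretch_rows_simps[of a] by auto
  have "envelope (stretched (bar_cells c (s + 1) a)) = envelope (bar_cells c (s + 1) a0)"
    using envelope_stretched[OF a(1,2)] a(4) by simp
  also have "\<dots> = zigzag (\<lambda>y. c - E y) s t"
    using envelope_zigzag[OF a0 a0_pos, of "s + 1" c] wells st
    by (simp add: L max_L) (simp add: a0_def)
  also have "\<dots> = S" using E_D unfolding S zigzag_def by auto
  finally show ?thesis using a(1-3) bargraphs_iff by blast
qed

lemma envelope_stretched_bij:
  assumes "1 \<le> w"
  shows "bij_betw (\<lambda>P. envelope (stretched P)) (bargraphs w) {S. bubble (w + 1) S}"
proof (rule bij_betw_imageI)
  show "inj_on (\<lambda>P. envelope (stretched P)) (bargraphs w)"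
  proof (rule inj_onI)
    fix P P' assume PP: "P \<in> bargraphs w" "P' \<in> bargraphs w"
      and eq: "envelope (stretched P) = envelope (stretched P')"
    obtain c b a where P: "P = bar_cells c b a" "a \<noteq> []" "0 \<notin> set a"
      using PP bargraphs_iff by metis
    obtain c' b' a' where P': "P' = bar_cells c' b' a'" "a' \<noteq> []" "0 \<notin> set a'"
      using PP bargraphs_iff by metis
    have "c = c'" "b = b'" "stretch_rows a = stretch_rows a'"
      using envelope_inject[of "stretch_rows a" "stretch_rows a'" c b c' b'] eq P P'
      by (simp_all add: envelope_stretched stretch_rows_simps)
    then show "P = P'" using stretch_rows_inject P P' by blast
  qed
  show "(\<lambda>P. envelope (stretched P)) ` bargraphs w = {S. bubble (w + 1) S}"
    using envelope_stretched_bubble bubble_is_envelope assms by blast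
qed

lemma envelope_stretched_translate:
  assumes "P \<in> bargraphs w"
  shows "envelope (stretched (translate u v P)) = translate u v (envelope (stretched P))"
proof -
  obtain c b a where P: "P = bar_cells c b a" "a \<noteq> []" "0 \<notin> set a"
    using assms bargraphs_iff by metis
  then have s: "stretch_rows a \<noteq> []" "0 \<notin> set (stretch_rows a)" by (simp_all add: stretch_rows_simps)
  let ?L = "row_len b (stretch_rows a)"
  have "(\<exists>y' \<in> {y - 1..y + 1}. Q (y' - v)) \<longleftrightarrow> (\<exists>y' \<in> {y - v - 1..y - v + 1}. Q y')" for Q y
  proof
    assume "\<exists>y' \<in> {y - v - 1..y - v + 1}. Q y'"
    then obtain z where "z \<in> {y - v - 1..y - v + 1}" "Q z" by blast
    then show "\<exists>y' \<in> {y - 1..y + 1}. Q (y' - v)" by (intro bexI[of _ "z + v"]) auto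
  qed force
  from this[of _ "\<lambda>z. 1 \<le> ?L z \<and> c + u - x \<le> ?L z" for x]
  have "(\<exists>y' \<in> {y - 1..y + 1}. 1 \<le> ?L (y' - v) \<and> c + u - x \<le> ?L (y' - v)) \<longleftrightarrow>
      (\<exists>y' \<in> {y - v - 1..y - v + 1}. 1 \<le> ?L y' \<and> c + u - x \<le> ?L y')" for x y .
  then show ?thesis
    unfolding P(1) translate_bar_cells envelope_stretched[OF P(2,3)] set_eq_iff split_paired_All
      mem_translate mem_envelope_bar_cells[OF s] row_len_shift diff_diff_eq2 by simp
qed

lemma translate_bargraphs: "P \<in> bargraphs w \<Longrightarrow> translate u v P \<in> bargraphs w"
  unfolding bargraphs_iff using translate_bar_cells by metis

theorem proposition11:
  fixes h :: nat
  assumes "2 \<le> h"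
  shows "bij_betw envelope_map (bargraph_classes (h - 1)) (bubble_classes h)"
proof -
  define F where "F P = envelope (stretched P)" for P
  have rel: "translation_rel `` {S} = range (\<lambda>(u, v). translate u v S)" for S
    by (auto simp: translation_rel_def)
  have "bij_betw ((`) F) (bargraphs (h - 1) // translation_rel) ({S. bubble h S} // translation_rel)"
  proof (rule bij_betw_quotient[OF equiv_translation_rel])
    show "bij_betw F (bargraphs (h - 1)) {S. bubble h S}"
      using envelope_stretched_bij[of "h - 1"] assms unfolding F_def by simp
    fix P assume P: "P \<in> bargraphs (h - 1)"
    then show "translation_rel `` {P} \<subseteq> bargraphs (h - 1)"
      unfolding rel by (auto simp: translate_bargraphs)
    \<comment> \<open>Both sides range over the same shifts \<open>(u, v)\<close> and agree shift by
      shift.\<close>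
    show "F ` (translation_rel `` {P}) = translation_rel `` {F P}"
      unfolding rel image_image F_def
      by (intro image_cong refl) (auto simp: envelope_stretched_translate[OF P])
  qed
  then show ?thesis
    unfolding bargraph_classes_def bubble_classes_def envelope_map_def F_def .
qed

end
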